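(* Let $a,b,c$ be real numbers, not all zero, and let $\{\mathcal{J}g_{n}^{(3)}\}_{n\geq 0}$ be the generalized Gaussian third-order Jacobsthal sequence with parameters $a,b,c$. Then for every integer $n\geq 0$, $$ \mathcal{J}g_{n}^{(3)}=\frac{1}{7}\Big\{(a+b+c)\left(1+\tfrac{i}{2}\right)2^{n}+\left[4a+4b-3c+(2a-5b+2c)i\right]\Omega_{n}+\left[6a-b-c-(4a+4b-3c)i\right]\Omega_{n+1}\Big\}. $$
   Context: Here $i$ is the imaginary unit. The generalized Gaussian third-order Jacobsthal sequence with real parameters $a,b,c$ (not all zero) is the sequence of complex numbers defined by $\mathcal{J}g_{n+3}^{(3)}=\mathcal{J}g_{n+2}^{(3)}+\mathcal{J}g_{n+1}^{(3)}+2\mathcal{J}g_{n}^{(3)}$ for $n\ge 0$, with $\mathcal{J}g_{0}^{(3)}=a+\frac{1}{2}(c-b-a)i$, $\mathcal{J}g_{1}^{(3)}=b+ai$, $\mathcal{J}g_{2}^{(3)}=c+bi$. For an integer $n$, $\Omega_{n}=\frac{\omega_1^n-\omega_2^n}{\omega_1-\omega_2}$, where $\omega_1,\omega_2$ are the roots of $x^2+x+1=0$; equivalently $\Omega_n=0,1,-1$ according as $n\equiv 0,1,2 \pmod 3$. *)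

theory Defs
  imports Complex_Main
begin

fun Jg :: "real \<Rightarrow> real \<Rightarrow> real \<Rightarrow> nat \<Rightarrow> complex" where
  "Jg a b c 0 = complex_of_real a + complex_of_real (1/2 * (c - b - a)) * \<i>"
| "Jg a b c (Suc 0) = complex_of_real b + complex_of_real a * \<i>"
| "Jg a b c (Suc (Suc 0)) = complex_of_real c + complex_of_real b * \<i>"
| "Jg a b c (Suc (Suc (Suc n))) =
     Jg a b c (Suc (Suc n)) + Jg a b c (Suc n) + 2 * Jg a b c n"

definition omega1 :: complex where
  "omega1 = (-1 + complex_of_real (sqrt 3) * \<i>) / 2"

definition omega2 :: complex where
  "omega2 = (-1 - complex_of_real (sqrt 3) * \<i>) / 2"

lemma omega_roots: "{x :: complex. x^2 + x + 1 = 0} = {omega1, omega2}"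
proof -
  have s: "complex_of_real (sqrt 3) * complex_of_real (sqrt 3) = 3"
    by (simp flip: of_real_mult)
  have 1: "omega1 + omega2 = -1"
    by (simp add: omega1_def omega2_def field_simps)
  have 2: "omega1 * omega2 = 1"
    by (simp add: omega1_def omega2_def algebra_simps s)
  have "x^2 + x + 1 = (x - omega1) * (x - omega2)" for x
  proof -
    have "(x - omega1) * (x - omega2) = x^2 - (omega1 + omega2) * x + omega1 * omega2"
      by (simp add: power2_eq_square algebra_simps)
    then show ?thesis by (simp add: 1 2)
  qed
  then show ?thesis by auto
qed

(* The two roots enter symmetrically, so their labelling is immaterial. *)
definition Omega :: "int \<Rightarrow> complex" where
  "Omega n = (omega1 powi n - omega2 powi n) / (omega1 - omega2)"

end

theory Submission
  imports Defs
begin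

(* The recurrence has characteristic polynomial x^3 - x^2 - x - 2 = (x - 2)(x^2 + x + 1), so
   2^n, Omega n and Omega (n + 1) all satisfy it; it remains to compare three initial values. *)

text \<open>A third-order linear recurrence is determined by three consecutive values. For the
  \<open>Omega\<close> terms it follows from \<open>Omega_add_2\<close> and
  \<open>Omega_add_3\<close>: the sum of two consecutive values is minus the next one, so
  \<open>Omega (k + 2) + Omega (k + 1) + 2 * Omega k\<close> equals \<open>Omega k\<close>, which is
  \<open>Omega (k + 3)\<close>.\<close>

lemma omega1_neq_omega2: "omega1 \<noteq> omega2"
  by (simp add: omega1_def omega2_def complex_eq_iff)

lemma Omega_0 [simp]: "Omega 0 = 0"
  by (simp add: Omega_def)

lemma Omega_1 [simp]: "Omega 1 = 1"
  using omega1_neq_omega2 by (simp add: Omega_def)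

text \<open>The equation multiplied by \<open>x powi k\<close>; negative \<open>k\<close> is allowed
  because 0 is not a root.\<close>

lemma root_powi_add_2:
  fixes x :: complex
  assumes "x^2 + x + 1 = 0"
  shows "x powi (k + 2) = - (x powi (k + 1)) - x powi k"
proof -
  have "x \<noteq> 0"
    using assms by auto
  then have "x powi (k + 2) + x powi (k + 1) + x powi k = x powi k * (x^2 + x + 1)"
    by (simp add: power_int_add algebra_simps)
  also have "\<dots> = 0"
    by (simp add: assms)
  finally show ?thesis
    by algebra
qed

lemma Omega_add_2: "Omega (k + 2) = - Omega (k + 1) - Omega k"
proof -
  have "omega1^2 + omega1 + 1 = 0" "omega2^2 + omega2 + 1 = 0"
    using omega_roots by blast+
  from this[THEN root_powi_add_2, of k] show ?thesis
    by (simp add: Omega_def diff_divide_distrib add_divide_distrib)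
qed

lemma Omega_2 [simp]: "Omega 2 = -1"
  using Omega_add_2[of 0] by simp

text \<open>Two consecutive instances of \<open>Omega_add_2\<close> cancel; this reflects that the
  roots are cube roots of unity.\<close>

lemma Omega_add_3: "Omega (k + 3) = Omega k"
  using Omega_add_2[of k] Omega_add_2[of "k + 1"] by (simp add: add.assoc)

lemma Omega_3 [simp]: "Omega 3 = 0"
  using Omega_add_3[of 0] by simp

theorem theorem2p3:
  fixes a b c :: real and n :: nat
  assumes "\<not> (a = 0 \<and> b = 0 \<and> c = 0)"
  shows "Jg a b c n = 1/7 *
    (complex_of_real (a + b + c) * (1 + \<i> / 2) * 2 ^ n
     + (complex_of_real (4*a + 4*b - 3*c) + complex_of_real (2*a - 5*b + 2*c) * \<i>) * Omega (int n)
     + (complex_of_real (6*a - b - c) - complex_of_real (4*a + 4*b - 3*c) * \<i>) * Omega (int n + 1))"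
proof -
  \<comment> \<open>The coefficients stay opaque in the inductive step, which is linear in them;
    only the three initial values need their actual form.\<close>
  define P Q R where
    "P = complex_of_real (a + b + c) * (1 + \<i> / 2)" and
    "Q = complex_of_real (4*a + 4*b - 3*c) + complex_of_real (2*a - 5*b + 2*c) * \<i>" and
    "R = complex_of_real (6*a - b - c) - complex_of_real (4*a + 4*b - 3*c) * \<i>"
  have "Jg a b c n = 1/7 * (P * 2 ^ n + Q * Omega (int n) + R * Omega (int n + 1))"
  proof (induction n rule: less_induct)
    case (less n)
    consider "n = 0" | "n = 1" | "n = 2" | m where "n = m + 3"
      by (cases "(a, b, c, n)" rule: Jg.cases) (auto simp: numeral_eq_Suc)
    then show ?case
    proof cases
      case 4
      have Om: "Omega (int m + 2) = - Omega (int m + 1) - Omega (int m)"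
        "Omega (int m + 3) = Omega (int m)" "Omega (int m + 4) = Omega (int m + 1)"
        using Omega_add_2[of "int m"] Omega_add_3[of "int m"] Omega_add_3[of "int m + 1"]
        by (simp_all add: add.assoc)
      have "Jg a b c n = Jg a b c (m + 2) + Jg a b c (m + 1) + 2 * Jg a b c m"
        by (simp add: 4 numeral_eq_Suc)
      also have "\<dots> = 1/7 * (P * 2 ^ n + Q * Omega (int n) + R * Omega (int n + 1))"
        \<comment> \<open>Keeping \<open>m + 2\<close> out of \<open>Suc\<close> form lets its cast
          become \<open>int m + 2\<close>, as in \<open>Om\<close>.\<close>
        by (simp add: 4 less.IH add.assoc Om power_add del: add_2_eq_Suc add_2_eq_Suc')
          (simp add: Om field_simps)
      finally show ?thesis .
    qed (simp_all add: P_def Q_def R_def numeral_2_eq_2 complex_eq_iff field_simps)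
  qed
  then show ?thesis
    by (simp only: P_def Q_def R_def)
qed

end
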